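(* The Cauchy problem for the two-dimensional Burgers equation with the datum $\delta_0$ (the Dirac mass at the origin of $\mathbb{R}^2$) is ill-posed in one sense or another: either an admissible solution with datum $\delta_0$ does not exist, or it is not self-similar (and thus it is not unique), or it is not the pointwise limit of entropy solutions associated with approximate data. That is: no admissible solution $u$ with datum $\delta_0$ is both self-similar and the pointwise almost everywhere limit on $(0,\infty)\times\mathbb{R}^2$ of a sequence $u_m(t)=S_ta_m$ associated with approximate data $a_m$ of $\delta_0$; moreover, if there is an admissible solution with datum $\delta_0$ which is not self-similar, then the admissible solution with datum $\delta_0$ is not unique.
   Context: The two-dimensional Burgers equation is $$\partial_tu+\partial_1\frac{u^2}2+\partial_2\frac{u^3}3=0,\qquad t>0,\ x\in\mathbb{R}^2.$$ Write $f(u)=(u^2/2,u^3/3)$. $\mathcal{M}(\mathbb{R}^2)$ is the space of bounded (signed, finite) Radon measures with total variation norm $\|\cdot\|_{\mathcal M}$. For $b\in L^1\cap L^\infty(\mathbb{R}^2)$, $S_tb:=u(t)$ denotes Kruzhkov's semigroup, that is, $u\in L^\infty(\mathbb{R}_+\times\mathbb{R}^2)\cap C(\mathbb{R}_+;L^1(\mathbb{R}^2))$ is the unique admissible (Kruzhkov entropy) solution with initial data $b$. It is known (Serre–Silvestre) that there is a universal constant $c_\infty<\infty$ with $\|S_tb\|_\infty\le c_\infty t^{-1/2}\|b\|_1^{1/4}$ for all $t>0$ and $b\in L^1\cap L^\infty(\mathbb{R}^2)$. Entropy solution on $(0,\infty)\times\mathbb{R}^2$: a function $u$, bounded on $(\tau,\infty)\times\mathbb{R}^2$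 for every $\tau>0$, satisfying $$\int_0^\infty\int_{\mathbb{R}^2}(u\,\partial_t\phi+f(u)\cdot\nabla_x\phi)\,dx\,dt=0\quad\text{for all }\phi\in C_c^\infty((0,\infty)\times\mathbb{R}^2),$$ and $$\int_0^\infty\int_{\mathbb{R}^2}\big(|u-k|\,\partial_t\phi+\mathrm{sgn}(u-k)(f(u)-f(k))\cdot\nabla_x\phi\big)\,dx\,dt\ge0$$ for all $k\in\mathbb{R}$ and all non-negative $\phi\in C_c^\infty((0,\infty)\times\mathbb{R}^2)$. Admissible solution with datum $a\in\mathcal{M}(\mathbb{R}^2)$: an entropy solution $u\in L^\infty(0,\infty;L^1(\mathbb{R}^2))$ on $(0,\infty)\times\mathbb{R}^2$ such that $u(t)\to a$ in the narrow sense as $t\to0+$ (for the essential limit in $t$), i.e. $\int u(t,x)\psi(x)\,dx\to\langle a,\psi\rangle$ for every bounded continuous $\psi$. Self-similar: $u$ is self-similar if for every $\mu>0$, $\sqrt\mu\,u(\mu t,\sqrt\mu\,x_1,x_2)=u(t,x_1,x_2)$ almost everywhere; equivalently $u(t,x)=t^{-1/2}W(x_1t^{-1/2},x_2)$ for some profile $W$. (The scaling $u\mapsto\sqrt\mu\,u(\mu t,\sqrt\mu\,x_1,x_2)$ maps entropy solutions to entropy solutions.) Approximate data of a measure $a$ supported by the vertical axis $\{x_1=0\}$: a sequence $a_m\in L^1\cap L^\infty(\mathbb{R}^2)$ converging narrowly to $a$, with ${\rm Supp}\,a_m\subset[-\frac1m,\frac1m]\times\mathbb{R}$ and $\|a_m\|_1\le\|a\|_{\mathcal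 M}$. *)

theory Defs
  imports "HOL-Probability.Probability"
begin

primrec Cn :: "nat \<Rightarrow> ('a::euclidean_space \<Rightarrow> real) \<Rightarrow> bool" where
  "Cn 0 \<phi> \<longleftrightarrow> continuous_on UNIV \<phi>"
| "Cn (Suc n) \<phi> \<longleftrightarrow>
     (\<forall>z. \<phi> differentiable (at z)) \<and> (\<forall>v. Cn n (\<lambda>z. frechet_derivative \<phi> (at z) v))"

type_synonym plane = "real \<times> real"

text \<open>Points of space-time are \<open>(t, x1, x2)\<close>.  A function in
  \<open>C\<^sub>c\<^sup>\<infinity>((0,\<infinity>) \<times> R\<^sup>2)\<close> is identified with its extension by zero to \<open>R \<times> R\<^sup>2\<close>.\<close>

definition half_space :: "(real \<times> plane) set" where
  "half_space = {0<..} \<times> UNIV"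

definition test_function :: "(real \<times> plane \<Rightarrow> real) \<Rightarrow> bool" where
  "test_function \<phi> \<longleftrightarrow>
     (\<forall>n. Cn n \<phi>) \<and> compact (closure {z. \<phi> z \<noteq> 0}) \<and> closure {z. \<phi> z \<noteq> 0} \<subseteq> half_space"

definition dt :: "(real \<times> plane \<Rightarrow> real) \<Rightarrow> real \<times> plane \<Rightarrow> real" where
  "dt \<phi> z = frechet_derivative \<phi> (at z) (1, 0, 0)"

definition grad_x :: "(real \<times> plane \<Rightarrow> real) \<Rightarrow> real \<times> plane \<Rightarrow> plane" where
  "grad_x \<phi> z = (frechet_derivative \<phi> (at z) (0, 1, 0), frechet_derivative \<phi> (at z) (0, 0, 1))"

definition flux :: "real \<Rightarrow> plane" where
  "flux u = (u\<^sup>2 / 2, u ^ 3 / 3)"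

text \<open>Elements of the Lebesgue spaces are handled through Borel representatives (every class has
  one), and bounds and equalities are understood almost everywhere.  Values \<open>u t\<close> for \<open>t \<le> 0\<close>
  are irrelevant here.\<close>

definition entropy_solution :: "(real \<Rightarrow> plane \<Rightarrow> real) \<Rightarrow> bool" where
  "entropy_solution u \<longleftrightarrow>
     set_borel_measurable lborel half_space (\<lambda>(t, x). u t x) \<and>
     (\<forall>\<tau>>0. \<exists>M. AE (t, x) in lborel. t > \<tau> \<longrightarrow> \<bar>u t x\<bar> \<le> M) \<and>
     (\<forall>\<phi>. test_function \<phi> \<longrightarrow>
        (LINT (t, x):half_space|lborel.
           u t x * dt \<phi> (t, x) + flux (u t x) \<bullet> grad_x \<phi> (t, x)) = 0) \<and>
     (\<forall>k \<phi>. test_function \<phi> \<and> (\<forall>z. \<phi> z \<ge> 0) \<longrightarrow>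
        (LINT (t, x):half_space|lborel.
           \<bar>u t x - k\<bar> * dt \<phi> (t, x)
             + sgn (u t x - k) * ((flux (u t x) - flux k) \<bullet> grad_x \<phi> (t, x))) \<ge> 0)"

definition bounded_continuous :: "(plane \<Rightarrow> real) \<Rightarrow> bool" where
  "bounded_continuous \<psi> \<longleftrightarrow> continuous_on UNIV \<psi> \<and> bounded (range \<psi>)"

text \<open>The datum \<open>a\<close> is a finite non-negative Borel measure on the plane; its total variation
  norm is its total mass.  The last clause is the narrow convergence
  \<open>u(t) \<rightarrow> a\<close> as \<open>t \<rightarrow> 0+\<close>, the limit in \<open>t\<close> being an essential limit.\<close>

definition admissible_solution :: "plane measure \<Rightarrow> (real \<Rightarrow> plane \<Rightarrow> real) \<Rightarrow> bool" where
  "admissible_solution a u \<longleftrightarrow>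
     entropy_solution u \<and>
     (\<exists>C. AE t in lborel. t > 0 \<longrightarrow> integrable lborel (u t) \<and> (LINT x|lborel. \<bar>u t x\<bar>) \<le> C) \<and>
     (\<forall>\<psi>. bounded_continuous \<psi> \<longrightarrow>
        (\<forall>\<epsilon>>0. \<exists>\<delta>>0. AE t in lborel. 0 < t \<and> t < \<delta> \<longrightarrow>
           \<bar>(LINT x|lborel. u t x * \<psi> x) - (LINT x|a. \<psi> x)\<bar> < \<epsilon>))"

definition self_similar :: "(real \<Rightarrow> plane \<Rightarrow> real) \<Rightarrow> bool" where
  "self_similar u \<longleftrightarrow>
     (\<forall>\<mu>>0. AE (t, x1, x2) in lborel. t > 0 \<longrightarrow>
        sqrt \<mu> * u (\<mu> * t) (sqrt \<mu> * x1, x2) = u t (x1, x2))"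

definition L1_Linf :: "(plane \<Rightarrow> real) \<Rightarrow> bool" where
  "L1_Linf b \<longleftrightarrow> integrable lborel b \<and> (\<exists>M. AE x in lborel. \<bar>b x\<bar> \<le> M)"

text \<open>\<open>kruzhkov_solution b u\<close> says that \<open>u t = S\<^sub>t b\<close> for all \<open>t \<ge> 0\<close>.  Since
  \<open>t \<mapsto> u t\<close> is continuous into \<open>L\<^sup>1\<close> up to \<open>t = 0\<close>, the initial condition is
  \<open>u 0 = b\<close> and the test functions may be supported in \<open>t > 0\<close>.\<close>

definition kruzhkov_solution :: "(plane \<Rightarrow> real) \<Rightarrow> (real \<Rightarrow> plane \<Rightarrow> real) \<Rightarrow> bool" where
  "kruzhkov_solution b u \<longleftrightarrow>
     entropy_solution u \<and>
     (\<exists>M. AE (t, x) in lborel. t > 0 \<longrightarrow> \<bar>u t x\<bar> \<le> M) \<and>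
     (\<forall>t\<ge>0. integrable lborel (u t)) \<and>
     (\<forall>s\<ge>0. ((\<lambda>t. LINT x|lborel. \<bar>u t x - u s x\<bar>) \<longlongrightarrow> 0) (at s within {0..})) \<and>
     (AE x in lborel. u 0 x = b x)"

text \<open>Support of a function in the sense of distributions: the complement of the largest open set
  on which it vanishes almost everywhere.\<close>

definition ess_support :: "(plane \<Rightarrow> real) \<Rightarrow> plane set" where
  "ess_support b = - \<Union>{U. open U \<and> (AE x in lborel. x \<in> U \<longrightarrow> b x = 0)}"

text \<open>Sequences are indexed by \<open>m \<ge> 1\<close>; the term of index \<open>0\<close> plays no role.\<close>

definition approximate_data :: "plane measure \<Rightarrow> (nat \<Rightarrow> plane \<Rightarrow> real) \<Rightarrow> bool" where
  "approximate_data a b \<longleftrightarrow>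
     (\<forall>m\<ge>1. L1_Linf (b m) \<and>
        ess_support (b m) \<subseteq> {- 1 / real m .. 1 / real m} \<times> UNIV \<and>
        (LINT x|lborel. \<bar>b m x\<bar>) \<le> measure a (space a)) \<and>
     (\<forall>\<psi>. bounded_continuous \<psi> \<longrightarrow>
        (\<lambda>m. LINT x|lborel. b m x * \<psi> x) \<longlonglongrightarrow> (LINT x|a. \<psi> x))"

definition dirac0 :: "plane measure" where
  "dirac0 = return borel (0, 0)"

end

theory Submission
  imports Defs
begin

text \<open>The self-similarity scaling leaves \<open>x2\<close> untouched and preserves mass, so the marginal in
  \<open>x2\<close> of a self-similar solution does not depend on \<open>t\<close>.  Letting \<open>t \<rightarrow> 0+\<close>, this
  marginal is the Dirac mass at \<open>0\<close>, which is impossible for an integrable function.  Since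
  the datum \<open>\<delta>\<^sub>0\<close> is invariant under the scaling, rescaling a solution which is not self-similar
  yields a different one.\<close>

section \<open>Diagonal linear changes of variables\<close>

text \<open>The sum over \<open>Basis\<close> is the shape in which
  \<open>lborel_affine_euclidean\<close> states the change of variables; one definition then serves
  both the plane and space-time.\<close>

definition diagonal :: "('a \<Rightarrow> real) \<Rightarrow> 'a \<Rightarrow> 'a::euclidean_space" where
  "diagonal d x = (\<Sum>j\<in>Basis. (d j * (x \<bullet> j)) *\<^sub>R j)"

lemma diagonal_eqI:
  assumes "\<And>j. j \<in> Basis \<Longrightarrow> y \<bullet> j = d j * (x \<bullet> j)"
  shows "diagonal d x = y"
  by (rule euclidean_eqI) (simp add: diagonal_def assms)

lemma borel_measurable_diagonal [measurable]: "diagonal d \<in> borel_measurable borel"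
  unfolding diagonal_def by measurable

lemma diagonal_inverse:
  assumes "\<And>j. j \<in> Basis \<Longrightarrow> d j \<noteq> 0"
  shows "diagonal d (diagonal (\<lambda>j. 1 / d j) x) = x"
  by (rule diagonal_eqI) (simp add: diagonal_def assms)

text \<open>The affine change of variables with zero translation. Null sets, integrability and
  integrals are transferred below by rewriting \<open>lborel\<close> in this form, where the density
  is a positive constant.\<close>

lemma lborel_eq_density_diagonal:
  assumes "\<And>j. j \<in> Basis \<Longrightarrow> d j \<noteq> 0"
  shows "lborel = density (distr lborel borel (diagonal d)) (\<lambda>_. ennreal (\<Prod>j\<in>Basis. \<bar>d j\<bar>))"
  using lborel_affine_euclidean[of d 0] assms by (simp add: diagonal_def[abs_def])

lemma AE_lborel_diagonal:
  fixes d :: "'a::euclidean_space \<Rightarrow> real"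
  assumes d: "\<And>j. j \<in> Basis \<Longrightarrow> d j \<noteq> 0" and P: "AE x in lborel. P x"
  shows "AE x in lborel. P (diagonal d x)"
proof -
  have "0 < (\<Prod>j\<in>Basis. \<bar>d j\<bar>)"
    using d by (intro prod_pos) auto
  moreover have "AE x in density (distr lborel borel (diagonal d)) (\<lambda>_. ennreal (\<Prod>j\<in>Basis. \<bar>d j\<bar>)). P x"
    using P by (subst lborel_eq_density_diagonal[OF d, symmetric])
  ultimately have "AE x in distr lborel borel (diagonal d). P x"
    by (subst (asm) AE_density) auto
  then show ?thesis
    by (intro AE_distrD[of "diagonal d" lborel borel]) auto
qed

lemma integrable_lborel_diagonal:
  fixes f :: "'a::euclidean_space \<Rightarrow> real"
  assumes d: "\<And>j. j \<in> Basis \<Longrightarrow> d j \<noteq> 0" and f: "integrable lborel f"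
  shows "integrable lborel (\<lambda>x. f (diagonal d x))"
proof -
  define c where "c = (\<Prod>j\<in>Basis. \<bar>d j\<bar>)"
  have [measurable]: "f \<in> borel_measurable borel"
    using borel_measurable_integrable[OF f] by simp
  have c: "0 < c"
    unfolding c_def using d by (intro prod_pos) auto
  have "integrable (density (distr lborel borel (diagonal d)) (\<lambda>_. ennreal c)) f"
    unfolding c_def using f by (subst lborel_eq_density_diagonal[OF d, symmetric])
  then have "integrable (distr lborel borel (diagonal d)) (\<lambda>x. c * f x)"
    using c by (subst (asm) integrable_density) auto
  then show ?thesis
    using c by (subst (asm) integrable_distr_eq) auto
qed

text \<open>Stated for arbitrary \<open>f\<close>, so that the weak formulation can be scaled
  without a measurability proof for its integrands.\<close>

lemma integral_lborel_diagonal: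
  fixes f :: "'a::euclidean_space \<Rightarrow> real"
  assumes d: "\<And>j. j \<in> Basis \<Longrightarrow> d j \<noteq> 0"
  shows "(\<Prod>j\<in>Basis. \<bar>d j\<bar>) * (LINT x|lborel. f (diagonal d x)) = (LINT x|lborel. f x)"
proof (cases "f \<in> borel_measurable borel")
  case [measurable]: True
  let ?c = "\<Prod>j\<in>Basis. \<bar>d j\<bar>"
  have c: "0 < ?c"
    using d by (intro prod_pos) auto
  have "(LINT x|lborel. f x) = (LINT x|density (distr lborel borel (diagonal d)) (\<lambda>_. ennreal ?c). f x)"
    by (subst lborel_eq_density_diagonal[OF d, symmetric]) auto
  also have "\<dots> = ?c * (LINT x|lborel. f (diagonal d x))"
    using c by (simp add: integral_density integral_distr)
  finally show ?thesis by simp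
next
  \<comment> \<open>The map has a measurable inverse, so composing with it cannot make
    \<open>f\<close> measurable. Neither function is integrable, and both integrals take the default
    value 0.\<close>
  case False
  have "(\<lambda>x. f (diagonal d x)) \<notin> borel_measurable borel"
  proof
    assume [measurable]: "(\<lambda>x. f (diagonal d x)) \<in> borel_measurable borel"
    have "(\<lambda>x. f (diagonal d (diagonal (\<lambda>j. 1 / d j) x))) \<in> borel_measurable borel"
      by measurable
    with False show False
      by (simp add: diagonal_inverse[OF d])
  qed
  with False show ?thesis
    by (metis borel_measurable_integrable measurable_lborel2 mult_zero_right not_integrable_integral_eq)
qed

section \<open>The scaling of the equation\<close>

definition dilation :: "real \<Rightarrow> plane \<Rightarrow> plane" where
  "dilation \<mu> x = (sqrt \<mu> * fst x, snd x)"

definition st_dilation :: "real \<Rightarrow> real \<times> plane \<Rightarrow> real \<times> plane" where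
  "st_dilation \<mu> z = (\<mu> * fst z, dilation \<mu> (snd z))"

text \<open>The characteristic speeds are \<open>u\<close> and the square of \<open>u\<close>:
  factors \<open>\<mu>\<close> on time and \<open>sqrt \<mu>\<close> on the amplitude force
  \<open>sqrt \<mu>\<close> on \<open>x1\<close> and leave \<open>x2\<close> unscaled.\<close>

definition rescale :: "real \<Rightarrow> (real \<Rightarrow> plane \<Rightarrow> real) \<Rightarrow> real \<Rightarrow> plane \<Rightarrow> real" where
  "rescale \<mu> u t x = sqrt \<mu> * u (\<mu> * t) (dilation \<mu> x)"

lemma dilation_eq_diagonal: "dilation \<mu> = diagonal (\<lambda>j. (sqrt \<mu>, 1) \<bullet> j)"
  by (intro ext diagonal_eqI[symmetric]) (auto simp: dilation_def Basis_prod_def)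

lemma st_dilation_eq_diagonal: "st_dilation \<mu> = diagonal (\<lambda>j. (\<mu>, sqrt \<mu>, 1) \<bullet> j)"
  by (intro ext diagonal_eqI[symmetric]) (auto simp: st_dilation_def dilation_def Basis_prod_def)

lemma prod_Basis_plane: "(\<Prod>j\<in>Basis. f j) = f (1, 0) * f (0, 1)" for f :: "plane \<Rightarrow> real"
  by (simp add: Basis_prod_def)

lemma prod_Basis_space_time:
  "(\<Prod>j\<in>Basis. f j) = f (1, 0, 0) * f (0, 1, 0) * f (0, 0, 1)" for f :: "real \<times> plane \<Rightarrow> real"
proof -
  have "(Basis :: (real \<times> plane) set) = {(1, 0, 0), (0, 1, 0), (0, 0, 1)}"
    by (auto simp: Basis_prod_def zero_prod_def)
  then show ?thesis unfolding \<open>Basis = _\<close> by simp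
qed

lemma borel_measurable_dilation [measurable]: "dilation \<mu> \<in> borel_measurable borel"
  by (simp add: dilation_eq_diagonal)

lemma borel_measurable_st_dilation [measurable]: "st_dilation \<mu> \<in> borel_measurable borel"
  by (simp add: st_dilation_eq_diagonal)

context
  fixes \<mu> :: real
  assumes \<mu>: "\<mu> > 0"
begin

lemma AE_st_dilation: "AE z in lborel. P z \<Longrightarrow> AE z in lborel. P (st_dilation \<mu> z)"
  unfolding st_dilation_eq_diagonal by (rule AE_lborel_diagonal) (use \<mu> in \<open>auto simp: Basis_prod_def\<close>)

lemma integrable_dilation:
  "integrable lborel f \<Longrightarrow> integrable lborel (\<lambda>x. f (dilation \<mu> x))" for f :: "plane \<Rightarrow> real"
  unfolding dilation_eq_diagonal
  by (rule integrable_lborel_diagonal) (use \<mu> in \<open>auto simp: Basis_prod_def\<close>)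

text \<open>The Jacobian of \<open>dilation \<mu>\<close> equals the amplitude factor in
  \<open>rescale\<close>, which is why the scaling preserves mass.\<close>

lemma integral_dilation:
  fixes f :: "plane \<Rightarrow> real"
  shows "(LINT x|lborel. sqrt \<mu> * f (dilation \<mu> x)) = (LINT x|lborel. f x)"
proof -
  have "(\<Prod>j\<in>Basis. \<bar>(sqrt \<mu>, 1 :: real) \<bullet> j\<bar>) * (LINT x|lborel. f (dilation \<mu> x)) = (LINT x|lborel. f x)"
    unfolding dilation_eq_diagonal
    by (rule integral_lborel_diagonal[of "\<lambda>j. (sqrt \<mu>, 1) \<bullet> j" f]) (use \<mu> in \<open>auto simp: Basis_prod_def\<close>)
  then show ?thesis
    using \<mu> by (simp add: prod_Basis_plane)
qed

lemma integral_st_dilation: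
  fixes f :: "real \<times> plane \<Rightarrow> real"
  shows "(LINT z|lborel. \<mu> * sqrt \<mu> * f (st_dilation \<mu> z)) = (LINT z|lborel. f z)"
proof -
  have "(\<Prod>j\<in>Basis. \<bar>(\<mu>, sqrt \<mu>, 1 :: real) \<bullet> j\<bar>) * (LINT z|lborel. f (st_dilation \<mu> z)) = (LINT z|lborel. f z)"
    unfolding st_dilation_eq_diagonal
    by (rule integral_lborel_diagonal[of "\<lambda>j. (\<mu>, sqrt \<mu>, 1) \<bullet> j" f]) (use \<mu> in \<open>auto simp: Basis_prod_def\<close>)
  then show ?thesis
    using \<mu> by (simp add: prod_Basis_space_time)
qed

lemma AE_time_scale:
  fixes P :: "real \<Rightarrow> bool"
  assumes "AE t in lborel. P t"
  shows "AE t in lborel. P (\<mu> * t)"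
proof -
  have "AE t in lborel. P (diagonal (\<lambda>_. \<mu>) t)"
    by (rule AE_lborel_diagonal) (use \<mu> assms in auto)
  then show ?thesis by (simp add: diagonal_def)
qed

lemma dilation_inverse: "dilation \<mu> (dilation (1 / \<mu>) x) = x" "dilation (1 / \<mu>) (dilation \<mu> x) = x"
  using \<mu> by (auto simp: dilation_def real_sqrt_divide)

lemma st_dilation_inverse:
  "st_dilation \<mu> (st_dilation (1 / \<mu>) z) = z" "st_dilation (1 / \<mu>) (st_dilation \<mu> z) = z"
  using \<mu> by (auto simp: st_dilation_def dilation_inverse)

lemma st_dilation_in_half_space: "st_dilation \<mu> z \<in> half_space \<longleftrightarrow> z \<in> half_space"
  using \<mu> by (auto simp: half_space_def st_dilation_def mem_Times_iff zero_less_mult_iff)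

end

lemma bounded_linear_st_dilation: "bounded_linear (st_dilation \<mu>)"
  by (rule linear_conv_bounded_linear[THEN iffD1], rule linearI)
     (auto simp: st_dilation_def dilation_def algebra_simps)

section \<open>Test functions under the scaling\<close>

lemma frechet_derivative_compose_linear:
  assumes L: "bounded_linear L" and "\<phi> differentiable (at (L z))"
  shows "(\<lambda>z. \<phi> (L z)) differentiable (at z)"
    and "frechet_derivative (\<lambda>z. \<phi> (L z)) (at z) = (\<lambda>v. frechet_derivative \<phi> (at (L z)) (L v))"
proof -
  have "((\<lambda>z. \<phi> (L z)) has_derivative (\<lambda>v. frechet_derivative \<phi> (at (L z)) (L v))) (at z)"
    by (rule has_derivative_compose[OF bounded_linear_imp_has_derivative[OF L]])
       (use assms(2) frechet_derivative_works in blast)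
  then show "(\<lambda>z. \<phi> (L z)) differentiable (at z)"
    and "frechet_derivative (\<lambda>z. \<phi> (L z)) (at z) = (\<lambda>v. frechet_derivative \<phi> (at (L z)) (L v))"
    by (auto simp: differentiable_def dest: frechet_derivative_at)
qed

text \<open>Induction with \<open>\<phi>\<close> arbitrary: the derivative of the composition along
  \<open>v\<close> is again a composition with \<open>L\<close>, namely of the derivative of
  \<open>\<phi>\<close> along \<open>L v\<close>.\<close>

lemma Cn_compose_linear:
  fixes \<phi> :: "'a::euclidean_space \<Rightarrow> real" and L :: "'b::euclidean_space \<Rightarrow> 'a"
  assumes L: "bounded_linear L"
  shows "Cn n \<phi> \<Longrightarrow> Cn n (\<lambda>z. \<phi> (L z))"
proof (induction n arbitrary: \<phi>)
  case 0
  then show ?case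
    using continuous_on_compose2[of UNIV \<phi> UNIV L] linear_continuous_on[OF L] by auto
next
  case (Suc n)
  then show ?case
    using Suc.IH[of "\<lambda>z. frechet_derivative \<phi> (at z) (L v)" for v]
    by (simp add: frechet_derivative_compose_linear[OF L])
qed

text \<open>The new support is the image of the old one under the inverse dilation. That map is a
  linear injection, hence commutes with closure and preserves compactness, and it leaves
  \<open>half_space\<close> invariant.\<close>

lemma test_function_dilation:
  assumes \<mu>: "\<mu> > 0" and \<phi>: "test_function \<phi>"
  shows "test_function (\<lambda>z. \<phi> (st_dilation \<mu> z))"
proof -
  let ?S = "st_dilation (1 / \<mu>)" and ?K = "closure {z. \<phi> z \<noteq> 0}"
  have S: "bounded_linear ?S" by (rule bounded_linear_st_dilation)
  have "{z. \<phi> (st_dilation \<mu> z) \<noteq> 0} = ?S ` {z. \<phi> z \<noteq> 0}"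
    using st_dilation_inverse[OF \<mu>] by (auto intro!: rev_image_eqI)
  moreover have "inj ?S"
    by (rule inj_on_inverseI[where g = "st_dilation \<mu>"]) (simp add: st_dilation_inverse[OF \<mu>])
  ultimately have eq: "closure {z. \<phi> (st_dilation \<mu> z) \<noteq> 0} = ?S ` ?K"
    using closure_injective_linear_image[OF bounded_linear.linear[OF S]] by simp
  have "compact (?S ` ?K)"
    using \<phi> by (intro compact_continuous_image linear_continuous_on[OF S]) (simp add: test_function_def)
  moreover have "?S ` ?K \<subseteq> half_space"
    using \<phi> \<mu> st_dilation_in_half_space[of "1 / \<mu>"] by (auto simp: test_function_def)
  ultimately show ?thesis
    using \<phi> unfolding test_function_def eq
    by (simp add: Cn_compose_linear[OF bounded_linear_st_dilation])
qed

text \<open>Chain rule along the coordinate vectors, which are eigenvectors of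
  \<open>st_dilation \<mu>\<close>. A gradient transforms by the transposed matrix, here diagonal,
  hence by \<open>dilation \<mu>\<close> itself.\<close>

lemma derivatives_test_function_dilation:
  assumes "test_function \<phi>"
  shows "dt (\<lambda>z. \<phi> (st_dilation \<mu> z)) z = \<mu> * dt \<phi> (st_dilation \<mu> z)"
    and "grad_x (\<lambda>z. \<phi> (st_dilation \<mu> z)) z = dilation \<mu> (grad_x \<phi> (st_dilation \<mu> z))"
proof -
  have "Cn (Suc 0) \<phi>"
    using assms unfolding test_function_def by blast
  then have d: "\<phi> differentiable (at z)" for z by (simp del: split_paired_All)
  interpret D: linear "frechet_derivative \<phi> (at (st_dilation \<mu> z))"
    by (rule linear_frechet_derivative[OF d])
  have "st_dilation \<mu> (1, 0, 0) = \<mu> *\<^sub>R (1, 0, 0)" "st_dilation \<mu> (0, 1, 0) = sqrt \<mu> *\<^sub>R (0, 1, 0)"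
    "st_dilation \<mu> (0, 0, 1) = (0, 0, 1)"
    by (auto simp: st_dilation_def dilation_def)
  then show "dt (\<lambda>z. \<phi> (st_dilation \<mu> z)) z = \<mu> * dt \<phi> (st_dilation \<mu> z)"
    and "grad_x (\<lambda>z. \<phi> (st_dilation \<mu> z)) z = dilation \<mu> (grad_x \<phi> (st_dilation \<mu> z))"
    unfolding dt_def grad_x_def frechet_derivative_compose_linear[OF bounded_linear_st_dilation d]
    by (simp_all only: D.scaleR dilation_def fst_conv snd_conv real_scaleR_def)
qed

section \<open>Solutions under the scaling\<close>

text \<open>The square yields \<open>\<mu>\<close> and the gradient another
  \<open>sqrt \<mu>\<close>; the cube yields \<open>\<mu> * sqrt \<mu>\<close> and the gradient 1.
  The time term gains the same total factor, which is the Jacobian of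
  \<open>st_dilation \<mu>\<close>.\<close>

lemma flux_scale: "flux (sqrt \<mu> * u) \<bullet> dilation \<mu> p = \<mu> * sqrt \<mu> * (flux u \<bullet> p)" if "\<mu> > 0"
proof -
  have "(sqrt \<mu>)\<^sup>2 = \<mu>" "(sqrt \<mu>) ^ 3 = \<mu> * sqrt \<mu>"
    using that by (simp_all add: power3_eq_cube)
  then show ?thesis
    by (cases p) (simp add: flux_def dilation_def power_mult_distrib algebra_simps)
qed

text \<open>The factor in the hypothesis is the Jacobian of \<open>st_dilation \<mu>\<close>, and
  \<open>half_space\<close> is invariant under this map.\<close>

lemma set_integral_st_dilation:
  fixes f g :: "real \<Rightarrow> plane \<Rightarrow> real"
  assumes \<mu>: "\<mu> > 0"
    and "\<And>t x. f t x = \<mu> * sqrt \<mu> * g (\<mu> * t) (dilation \<mu> x)"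
  shows "(LINT (t, x):half_space|lborel. f t x) = (LINT (t, x):half_space|lborel. g t x)"
proof -
  let ?G = "\<lambda>z. indicator half_space z *\<^sub>R (case z of (t, x) \<Rightarrow> g t x)"
  have "indicator half_space z *\<^sub>R (case z of (t, x) \<Rightarrow> f t x) = \<mu> * sqrt \<mu> * ?G (st_dilation \<mu> z)" for z
    using st_dilation_in_half_space[OF \<mu>, of z]
    by (cases z) (simp add: assms(2) indicator_def st_dilation_def)
  then show ?thesis
    unfolding set_lebesgue_integral_def using integral_st_dilation[OF \<mu>, of ?G] by simp
qed

text \<open>Testing the rescaled function against \<open>\<phi>\<close> amounts to testing
  \<open>u\<close> against \<open>\<phi>\<close> composed with the inverse dilation.\<close>

lemma entropy_solution_rescale:
  assumes \<mu>: "\<mu> > 0" and u: "entropy_solution u"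
  shows "entropy_solution (rescale \<mu> u)"
  unfolding entropy_solution_def
proof (intro conjI allI impI)
  have [measurable]: "(\<lambda>z. indicator half_space z *\<^sub>R (case z of (t, x) \<Rightarrow> u t x)) \<in> borel_measurable borel"
    using u by (simp add: entropy_solution_def set_borel_measurable_def)
  have "(\<lambda>z. sqrt \<mu> * (indicator half_space (st_dilation \<mu> z)
      *\<^sub>R (case st_dilation \<mu> z of (t, x) \<Rightarrow> u t x))) \<in> borel_measurable borel"
    by measurable
  moreover have "sqrt \<mu> * (indicator half_space (st_dilation \<mu> z) *\<^sub>R (case st_dilation \<mu> z of (t, x) \<Rightarrow> u t x))
      = indicator half_space z *\<^sub>R (case z of (t, x) \<Rightarrow> rescale \<mu> u t x)" for z
    using st_dilation_in_half_space[OF \<mu>, of z]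
    by (cases z) (simp add: indicator_def st_dilation_def rescale_def)
  ultimately show "set_borel_measurable lborel half_space (\<lambda>(t, x). rescale \<mu> u t x)"
    by (simp add: set_borel_measurable_def)
next
  fix \<tau> :: real
  assume "0 < \<tau>"
  then obtain M where "AE (t, x) in lborel. t > \<mu> * \<tau> \<longrightarrow> \<bar>u t x\<bar> \<le> M"
    using u \<mu> unfolding entropy_solution_def by (meson mult_pos_pos)
  from AE_st_dilation[OF \<mu> this]
  have "AE (t, x) in lborel. t > \<tau> \<longrightarrow> \<bar>rescale \<mu> u t x\<bar> \<le> sqrt \<mu> * M"
    by eventually_elim (use \<mu> in \<open>auto simp: st_dilation_def rescale_def abs_mult\<close>)
  then show "\<exists>M. AE (t, x) in lborel. t > \<tau> \<longrightarrow> \<bar>rescale \<mu> u t x\<bar> \<le> M" ..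
next
  fix \<phi>
  assume \<phi>: "test_function \<phi>"
  define \<psi> where "\<psi> = (\<lambda>z. \<phi> (st_dilation (1 / \<mu>) z))"
  have \<psi>: "test_function \<psi>"
    unfolding \<psi>_def using \<mu> \<phi> by (intro test_function_dilation) auto
  have \<phi>_eq: "\<phi> = (\<lambda>z. \<psi> (st_dilation \<mu> z))"
    by (simp add: \<psi>_def st_dilation_inverse[OF \<mu>])
  have "(LINT (t, x):half_space|lborel. rescale \<mu> u t x * dt \<phi> (t, x) + flux (rescale \<mu> u t x) \<bullet> grad_x \<phi> (t, x))
     = (LINT (t, x):half_space|lborel. u t x * dt \<psi> (t, x) + flux (u t x) \<bullet> grad_x \<psi> (t, x))"
    unfolding \<phi>_eq derivatives_test_function_dilation[OF \<psi>]
    by (rule set_integral_st_dilation[OF \<mu>])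
       (simp add: rescale_def st_dilation_def flux_scale[OF \<mu>] algebra_simps)
  also have "\<dots> = 0"
    using u \<psi> by (simp add: entropy_solution_def)
  finally show "(LINT (t, x):half_space|lborel. rescale \<mu> u t x * dt \<phi> (t, x)
      + flux (rescale \<mu> u t x) \<bullet> grad_x \<phi> (t, x)) = 0" .
next
  fix k \<phi>
  assume \<phi>: "test_function \<phi> \<and> (\<forall>z. \<phi> z \<ge> 0)"
  define \<psi> where "\<psi> = (\<lambda>z. \<phi> (st_dilation (1 / \<mu>) z))"
  have \<psi>: "test_function \<psi>" "\<And>z. \<psi> z \<ge> 0"
    unfolding \<psi>_def using \<mu> \<phi> test_function_dilation[of "1 / \<mu>" \<phi>] by (simp_all del: split_paired_All)
  have \<phi>_eq: "\<phi> = (\<lambda>z. \<psi> (st_dilation \<mu> z))"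
    by (simp add: \<psi>_def st_dilation_inverse[OF \<mu>])
  \<comment> \<open>The Kruzhkov constant scales like \<open>u\<close>: level \<open>k\<close> for
    the rescaled function corresponds to level \<open>l\<close> for \<open>u\<close>.\<close>
  define l where "l = k / sqrt \<mu>"
  have k_eq: "k = sqrt \<mu> * l"
    using \<mu> by (simp add: l_def)
  have abs_eq: "\<bar>sqrt \<mu> * a - sqrt \<mu> * l\<bar> = sqrt \<mu> * \<bar>a - l\<bar>"
    and sgn_eq: "sgn (sqrt \<mu> * a - sqrt \<mu> * l) = sgn (a - l)" for a
    using \<mu> by (auto simp: abs_mult sgn_mult simp flip: right_diff_distrib)
  have "0 \<le> (LINT (t, x):half_space|lborel. \<bar>u t x - l\<bar> * dt \<psi> (t, x)
      + sgn (u t x - l) * ((flux (u t x) - flux l) \<bullet> grad_x \<psi> (t, x)))"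
    using u \<psi> by (simp add: entropy_solution_def)
  also have "\<dots> = (LINT (t, x):half_space|lborel. \<bar>rescale \<mu> u t x - k\<bar> * dt \<phi> (t, x)
      + sgn (rescale \<mu> u t x - k) * ((flux (rescale \<mu> u t x) - flux k) \<bullet> grad_x \<phi> (t, x)))"
    unfolding \<phi>_eq k_eq derivatives_test_function_dilation[OF \<psi>(1)]
    by (rule set_integral_st_dilation[OF \<mu>, symmetric])
       (simp only: rescale_def abs_eq sgn_eq inner_diff_left st_dilation_def fst_conv snd_conv flux_scale[OF \<mu>], simp add: algebra_simps)
  finally show "(LINT (t, x):half_space|lborel. \<bar>rescale \<mu> u t x - k\<bar> * dt \<phi> (t, x)
      + sgn (rescale \<mu> u t x - k) * ((flux (rescale \<mu> u t x) - flux k) \<bullet> grad_x \<phi> (t, x))) \<ge> 0" .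
qed

section \<open>Invariance of the Dirac datum under the scaling\<close>

lemma integral_dirac0:
  assumes "bounded_continuous \<psi>"
  shows "(LINT x|dirac0. \<psi> x) = \<psi> (0, 0)"
  unfolding dirac0_def using assms
  by (intro integral_return) (auto simp: bounded_continuous_def intro: borel_measurable_continuous_onI)

text \<open>The \<open>L1\<close> bound survives because mass is preserved. The datum survives
  because the dilation fixes the origin, the only point that \<open>dirac0\<close> sees.\<close>

lemma admissible_solution_rescale:
  assumes \<mu>: "\<mu> > 0" and u: "admissible_solution dirac0 u"
  shows "admissible_solution dirac0 (rescale \<mu> u)"
  unfolding admissible_solution_def
proof (intro conjI allI impI)
  show "entropy_solution (rescale \<mu> u)"
    using entropy_solution_rescale[OF \<mu>] u by (simp add: admissible_solution_def)
  obtain C where "AE t in lborel. t > 0 \<longrightarrow> integrable lborel (u t) \<and> (LINT x|lborel. \<bar>u t x\<bar>) \<le> C"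
    using u unfolding admissible_solution_def by blast
  from AE_time_scale[OF \<mu> this]
  have "AE t in lborel. t > 0 \<longrightarrow> integrable lborel (rescale \<mu> u t) \<and> (LINT x|lborel. \<bar>rescale \<mu> u t x\<bar>) \<le> C"
  proof eventually_elim
    case (elim t)
    have "(LINT x|lborel. \<bar>rescale \<mu> u t x\<bar>) = (LINT x|lborel. \<bar>u (\<mu> * t) x\<bar>)"
      using \<mu> integral_dilation[OF \<mu>, of "\<lambda>x. \<bar>u (\<mu> * t) x\<bar>"] by (simp add: rescale_def abs_mult)
    moreover have "integrable lborel (rescale \<mu> u t)" if "integrable lborel (u (\<mu> * t))"
      using integrable_dilation[OF \<mu> that] unfolding rescale_def by simp
    ultimately show ?case
      using elim \<mu> by auto
  qed
  then show "\<exists>C. AE t in lborel. t > 0 \<longrightarrow>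
      integrable lborel (rescale \<mu> u t) \<and> (LINT x|lborel. \<bar>rescale \<mu> u t x\<bar>) \<le> C" ..
next
  fix \<psi> and \<epsilon> :: real
  assume \<psi>: "bounded_continuous \<psi>" and \<epsilon>: "\<epsilon> > 0"
  \<comment> \<open>The scaling is moved from the solution to the observable; \<open>\<eta>\<close>
    and \<open>\<psi>\<close> agree at the origin.\<close>
  define \<eta> where "\<eta> = (\<lambda>x. \<psi> (dilation (1 / \<mu>) x))"
  have \<eta>: "bounded_continuous \<eta>"
    unfolding bounded_continuous_def
  proof
    have "continuous_on UNIV (dilation (1 / \<mu>))"
      unfolding dilation_def by (intro continuous_intros)
    then show "continuous_on UNIV \<eta>"
      using \<psi> unfolding \<eta>_def bounded_continuous_def
      by (auto intro: continuous_on_compose2)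
    show "bounded (range \<eta>)"
      by (rule bounded_subset[of "range \<psi>"]) (use \<psi> in \<open>auto simp: \<eta>_def bounded_continuous_def\<close>)
  qed
  have \<eta>0: "\<eta> (0, 0) = \<psi> (0, 0)"
    by (simp add: \<eta>_def dilation_def)
  obtain \<delta> where \<delta>: "\<delta> > 0"
    "AE t in lborel. 0 < t \<and> t < \<delta> \<longrightarrow> \<bar>(LINT x|lborel. u t x * \<eta> x) - (LINT x|dirac0. \<eta> x)\<bar> < \<epsilon>"
    using u \<eta> \<epsilon> unfolding admissible_solution_def by meson
  have eq: "(LINT x|lborel. rescale \<mu> u t x * \<psi> x) = (LINT x|lborel. u (\<mu> * t) x * \<eta> x)" for t
    using integral_dilation[OF \<mu>, of "\<lambda>x. u (\<mu> * t) x * \<eta> x"]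
    by (simp add: rescale_def \<eta>_def dilation_inverse[OF \<mu>] mult.assoc)
  have "AE t in lborel. 0 < t \<and> t < \<delta> / \<mu> \<longrightarrow>
      \<bar>(LINT x|lborel. rescale \<mu> u t x * \<psi> x) - (LINT x|dirac0. \<psi> x)\<bar> < \<epsilon>"
    using AE_time_scale[OF \<mu> \<delta>(2)]
    by eventually_elim
       (use \<mu> in \<open>auto simp: eq integral_dirac0[OF \<psi>] integral_dirac0[OF \<eta>] \<eta>0 pos_less_divide_eq mult.commute[of \<mu>]\<close>)
  then show "\<exists>\<delta>>0. AE t in lborel. 0 < t \<and> t < \<delta> \<longrightarrow>
      \<bar>(LINT x|lborel. rescale \<mu> u t x * \<psi> x) - (LINT x|dirac0. \<psi> x)\<bar> < \<epsilon>"
    using \<delta>(1) \<mu> by (intro exI[of _ "\<delta> / \<mu>"]) simp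
qed

lemma self_similar_iff_rescale:
  "self_similar u \<longleftrightarrow> (\<forall>\<mu>>0. AE (t, x) in lborel. t > 0 \<longrightarrow> rescale \<mu> u t x = u t x)"
  by (simp add: self_similar_def rescale_def dilation_def case_prod_beta)

section \<open>Self-similar solutions\<close>

lemma borel_measurable_snd_plane [measurable]: "snd \<in> borel_measurable (borel :: plane measure)"
  by (intro borel_measurable_continuous_onI continuous_intros)

text \<open>The weight depends on \<open>x2\<close> alone, which the dilation leaves fixed, so mass
  preservation applies to the weighted integral. The exceptional null set of times may depend on
  \<open>\<mu>\<close>.\<close>

lemma self_similar_marginal_invariant:
  assumes \<mu>: "\<mu> > 0" and u: "self_similar u"
    and int: "AE t in lborel. t > 0 \<longrightarrow> integrable lborel (u t)"
    and [measurable]: "g \<in> borel_measurable borel"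
  shows "AE t in lborel. t > 0 \<longrightarrow>
    (LINT x|lborel. u (\<mu> * t) x * g (snd x)) = (LINT x|lborel. u t x * g (snd x))"
proof -
  have "AE (t, x) in lborel \<Otimes>\<^sub>M lborel. t > 0 \<longrightarrow> rescale \<mu> u t x = u t x"
    unfolding lborel_prod using u \<mu> by (simp add: self_similar_iff_rescale)
  \<comment> \<open>Fubini for null sets: equality almost everywhere in space-time gives equality
    almost everywhere on almost every time slice.\<close>
  then have "AE t in lborel. AE x in lborel. t > 0 \<longrightarrow> rescale \<mu> u t x = u t x"
    using lborel_pair.AE_pair by fastforce
  with int AE_time_scale[OF \<mu> int] show ?thesis
  proof eventually_elim
    case (elim t)
    show ?case
    proof
      assume t: "t > 0"
      have [measurable]: "u t \<in> borel_measurable borel" "u (\<mu> * t) \<in> borel_measurable borel"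
        using elim(1,2) t \<mu> by (auto dest: borel_measurable_integrable)
      have [measurable]: "rescale \<mu> u t \<in> borel_measurable borel"
        unfolding rescale_def by measurable
      have "(LINT x|lborel. u (\<mu> * t) x * g (snd x)) = (LINT x|lborel. rescale \<mu> u t x * g (snd x))"
        using integral_dilation[OF \<mu>, of "\<lambda>x. u (\<mu> * t) x * g (snd x)"]
        by (simp add: rescale_def dilation_def mult.assoc)
      also have "\<dots> = (LINT x|lborel. u t x * g (snd x))"
        using elim(3) t by (intro integral_cong_AE) auto
      finally show "(LINT x|lborel. u (\<mu> * t) x * g (snd x)) = (LINT x|lborel. u t x * g (snd x))" .
    qed
  qed
qed

text \<open>The marginal integral \<open>h\<close> takes equal values at \<open>t\<close> and at
  arbitrarily small multiples of \<open>t\<close>, where it is close to its initial limit.\<close>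

lemma self_similar_marginal_dirac:
  assumes u: "admissible_solution dirac0 u" "self_similar u"
    and g: "continuous_on UNIV g" "bounded (range g)"
  shows "AE t in lborel. t > 0 \<longrightarrow> (LINT x|lborel. u t x * g (snd x)) = g 0"
proof -
  define h where "h = (\<lambda>t. LINT x|lborel. u t x * g (snd x))"
  have "continuous_on UNIV (\<lambda>x :: plane. g (snd x))"
    using g(1) by (auto intro!: continuous_on_compose2[of UNIV g] continuous_intros)
  moreover have "bounded (range (\<lambda>x :: plane. g (snd x)))"
    by (rule bounded_subset[OF g(2)]) auto
  ultimately have bc: "bounded_continuous (\<lambda>x. g (snd x))"
    by (simp add: bounded_continuous_def)
  \<comment> \<open>Countably many tolerances suffice for the limit and allow their exceptional null
    sets to be united.\<close>
  have small: "\<exists>\<delta>>0. AE t in lborel. 0 < t \<and> t < \<delta> \<longrightarrow> \<bar>h t - g 0\<bar> < 1 / Suc j" for j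
  proof -
    have "\<forall>\<epsilon>>0. \<exists>\<delta>>0. AE t in lborel. 0 < t \<and> t < \<delta> \<longrightarrow> \<bar>h t - (LINT x|dirac0. g (snd x))\<bar> < \<epsilon>"
      using u(1) bc unfolding admissible_solution_def h_def by blast
    moreover have "1 / real (Suc j) > 0" by simp
    ultimately show ?thesis
      unfolding integral_dirac0[OF bc] snd_conv by blast
  qed
  then obtain \<delta> where \<delta>: "\<And>j :: nat. \<delta> j > 0"
    "\<And>j. AE t in lborel. 0 < t \<and> t < \<delta> j \<longrightarrow> \<bar>h t - g 0\<bar> < 1 / Suc j"
    by metis
  have "AE t in lborel. t > 0 \<longrightarrow> integrable lborel (u t)"
    using u(1) unfolding admissible_solution_def by force
  \<comment> \<open>Since the null set depends on the factor, only a countable family of factors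
    tending to 0 is used.\<close>
  then have "AE t in lborel. \<forall>k. t > 0 \<longrightarrow> h ((1 / 2) ^ k * t) = h t"
    unfolding AE_all_countable h_def using g(1) u(2)
    by (intro allI self_similar_marginal_invariant borel_measurable_continuous_onI) simp_all
  \<comment> \<open>The estimate near 0 is needed at the scaled times; scaling maps null sets of
    times to null sets.\<close>
  moreover have "AE t in lborel. \<forall>k j. 0 < (1 / 2) ^ k * t \<and> (1 / 2) ^ k * t < \<delta> j
      \<longrightarrow> \<bar>h ((1 / 2) ^ k * t) - g 0\<bar> < 1 / Suc j"
    unfolding AE_all_countable by (intro allI AE_time_scale[OF _ \<delta>(2)]) simp
  ultimately have "AE t in lborel. t > 0 \<longrightarrow> h t = g 0"
  proof eventually_elim
    case (elim t)
    show ?case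
    proof
      assume t: "t > 0"
      have "\<bar>h t - g 0\<bar> < 1 / Suc j" for j
      proof -
        \<comment> \<open>This \<open>k\<close> brings the scaled time below
          \<open>\<delta> j\<close>.\<close>
        obtain k where "(1 / 2 :: real) ^ k < \<delta> j / t"
          using \<delta>(1)[of j] t real_arch_pow_inv[of "\<delta> j / t" "1 / 2"] by auto
        then show ?thesis
          using elim(1)[rule_format, OF t, of k] elim(2)[rule_format, of k j] t
          by (simp add: pos_less_divide_eq)
      qed
      then have "\<not> 0 < \<bar>h t - g 0\<bar>"
        by (metis nat_approx_posE less_asym)
      then show "h t = g 0" by simp
    qed
  qed
  then show ?thesis
    by (simp add: h_def)
qed

section \<open>Incompatibility of a Dirac marginal with integrability\<close>

text \<open>The exceptional set is a hyperplane, negligible for \<open>lebesgue\<close>; the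
  statement passes to \<open>lborel\<close> because \<open>lebesgue\<close> is its
  completion.\<close>

lemma AE_lborel_snd_nonzero: "AE x in lborel. snd (x :: plane) \<noteq> 0"
proof -
  have "{x :: plane. (0, 1) \<bullet> x = 0} \<in> null_sets lebesgue"
    using negligible_hyperplane[of "(0, 1) :: plane" 0] by (simp add: negligible_iff_null_sets zero_prod_def)
  then have "AE x in lebesgue. (0, 1) \<bullet> (x :: plane) \<noteq> 0"
    by (auto dest: AE_not_in)
  then show ?thesis
    by (simp add: AE_completion_iff inner_prod_def)
qed

text \<open>Weights in \<open>x2\<close> that concentrate at 0 would all have integral 1 against
  \<open>u t\<close>, while dominated convergence sends these integrals to 0.\<close>

lemma no_self_similar_admissible_solution:
  assumes "admissible_solution dirac0 u"
  shows "\<not> self_similar u"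
proof
  assume ss: "self_similar u"
  \<comment> \<open>Tent functions of height 1 that shrink to the point 0; \<open>g 0\<close> is the
    constant 1.\<close>
  define g where "g = (\<lambda>n y. max 0 (1 - real n * \<bar>y\<bar>))"
  have cont: "continuous_on UNIV (g n)" for n
    unfolding g_def by (intro continuous_intros)
  have g_le: "\<bar>g n y\<bar> \<le> 1" for n y
    by (simp add: g_def)
  then have "bounded (range (g n))" for n
    by (auto intro!: boundedI[of _ 1])
  then have "AE t in lborel. t > 0 \<longrightarrow> (LINT x|lborel. u t x * g n (snd x)) = 1" for n
    using self_similar_marginal_dirac[OF assms ss cont] by (simp add: g_def)
  then have "AE t in lborel. \<forall>n. t > 0 \<longrightarrow> (LINT x|lborel. u t x * g n (snd x)) = 1"
    unfolding AE_all_countable by blast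
  moreover have "AE t in lborel. t > 0 \<longrightarrow> integrable lborel (u t)"
    using assms unfolding admissible_solution_def by force
  \<comment> \<open>Almost every time in this interval leads to a contradiction, yet the interval
    has measure 1.\<close>
  ultimately have "AE t in lborel. t \<notin> {0<..<1 :: real}"
  proof eventually_elim
    case (elim t)
    show ?case
    proof
      assume "t \<in> {0<..<1}"
      then have int: "integrable lborel (u t)"
        and one: "\<And>n. (LINT x|lborel. u t x * g n (snd x)) = 1"
        using elim by auto
      have [measurable]: "u t \<in> borel_measurable borel" "g n \<in> borel_measurable borel" for n
        using int cont by (auto dest: borel_measurable_integrable intro: borel_measurable_continuous_onI)
      have "(\<lambda>n. LINT x|lborel. u t x * g n (snd x)) \<longlonglongrightarrow> (LINT x|(lborel :: plane measure). (0 :: real))"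
      proof (rule integral_dominated_convergence[where w = "\<lambda>x. \<bar>u t x\<bar>"])
        show "AE x in lborel. (\<lambda>n. u t x * g n (snd x)) \<longlonglongrightarrow> 0"
          using AE_lborel_snd_nonzero
        proof eventually_elim
          case (elim x)
          \<comment> \<open>From index \<open>N\<close> on, \<open>snd x\<close> lies outside the
            support of the tent.\<close>
          obtain N where "1 / \<bar>snd x\<bar> < real N"
            using reals_Archimedean2 by blast
          then have "g n (snd x) = 0" if "n \<ge> N" for n
          proof -
            have "1 / \<bar>snd x\<bar> < real n"
              using \<open>1 / \<bar>snd x\<bar> < real N\<close> that by linarith
            then show ?thesis
              using elim by (simp add: g_def divide_less_eq)
          qed
          then show ?case
            by (intro tendsto_eventually eventually_sequentiallyI[of N]) simp
        qed
        show "AE x in lborel. norm (u t x * g n (snd x)) \<le> \<bar>u t x\<bar>" for n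
          using g_le by (simp add: abs_mult mult_left_le)
      qed (use int in auto)
      then show False
        by (simp add: one LIMSEQ_const_iff)
    qed
  qed
  then have "{0<..<1 :: real} \<in> null_sets lborel"
    by (subst (asm) AE_iff_null_sets[symmetric]) auto
  then show False
    by (simp add: null_sets_def)
qed

theorem corollary5p1:
  shows
    "\<not> (\<exists>(u :: real \<Rightarrow> plane \<Rightarrow> real) (a :: nat \<Rightarrow> plane \<Rightarrow> real) (v :: nat \<Rightarrow> real \<Rightarrow> plane \<Rightarrow> real).
          admissible_solution dirac0 u \<and> self_similar u \<and>
          approximate_data dirac0 a \<and> (\<forall>m\<ge>1. kruzhkov_solution (a m) (v m)) \<and>
          (AE (t, x) in lborel. t > 0 \<longrightarrow> (\<lambda>m. v m t x) \<longlonglongrightarrow> u t x))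
     \<and>
     ((\<exists>u. admissible_solution dirac0 u \<and> \<not> self_similar u) \<longrightarrow>
       (\<exists>u w. admissible_solution dirac0 u \<and> admissible_solution dirac0 w \<and>
         \<not> (AE (t, x) in lborel. t > 0 \<longrightarrow> u t x = w t x)))"
proof (intro conjI impI)
  show "\<not> (\<exists>(u :: real \<Rightarrow> plane \<Rightarrow> real) (a :: nat \<Rightarrow> plane \<Rightarrow> real) (v :: nat \<Rightarrow> real \<Rightarrow> plane \<Rightarrow> real).
      admissible_solution dirac0 u \<and> self_similar u \<and>
      approximate_data dirac0 a \<and> (\<forall>m\<ge>1. kruzhkov_solution (a m) (v m)) \<and>
      (AE (t, x) in lborel. t > 0 \<longrightarrow> (\<lambda>m. v m t x) \<longlonglongrightarrow> u t x))"
    using no_self_similar_admissible_solution by blast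
next
  assume "\<exists>u. admissible_solution dirac0 u \<and> \<not> self_similar u"
  \<comment> \<open>Failure of self-similarity provides a factor for which
    \<open>rescale \<mu> u\<close> and \<open>u\<close> are distinct; these are the two solutions
    sought.\<close>
  then obtain u \<mu> where "admissible_solution dirac0 u" "\<mu> > 0"
    "\<not> (AE (t, x) in lborel. t > 0 \<longrightarrow> rescale \<mu> u t x = u t x)"
    unfolding self_similar_iff_rescale by blast
  then show "\<exists>u w. admissible_solution dirac0 u \<and> admissible_solution dirac0 w \<and>
      \<not> (AE (t, x) in lborel. t > 0 \<longrightarrow> u t x = w t x)"
    using admissible_solution_rescale by blast
qed

end
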